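(* Let $f,g:\mathbb{R}^n\to\mathbb{R}\cup\{\infty\}$ be proper, closed and convex. Assume that $\rho>0$ and $\gamma>0$ satisfy $\rho=\gamma^{-1}$, and that $z,v\in\mathbb{R}^n$ satisfy $z=\rho^{-1}v=\gamma v$. Then $$F_\rho^{\mathrm{ADMM}}(v)=-F_\gamma^{\mathrm{DR}}(z),$$ where $F_\gamma^{\mathrm{DR}}$ and $F_\rho^{\mathrm{ADMM}}$ are the Douglas-Rachford and ADMM envelopes of the pair $(f,g)$ defined in the context.
   Context: $\langle\cdot,\cdot\rangle$ is an inner product on $\mathbb{R}^n$ with induced norm $\|\cdot\|$. The conjugate of $\phi$ is $\phi^*(y)=\sup_x\{\langle y,x\rangle-\phi(x)\}$, and $(g^*\circ-\mathrm{Id})(\mu)=g^*(-\mu)$. For a proper closed convex $\phi$ and $\gamma>0$: $\mathrm{prox}_{\gamma\phi}(z)=\operatorname{argmin}_x\{\phi(x)+\tfrac1{2\gamma}\|x-z\|^2\}$; $r_{\gamma\phi}(x)=\gamma\phi(x)+\tfrac12\|x\|^2$ with conjugate $r_{\gamma\phi}^*$; $p_{\gamma\phi}^2(x)=2r_{\gamma\phi}^*(x)-\tfrac12\|x\|^2$ (the superscript $2$ is a parameter, not a square); and $R_{\gamma\phi}(x)=2\,\mathrm{prox}_{\gamma\phi}(x)-x$. The envelopes are $$F_\gamma^{\mathrm{DR}}(z)=(2\gamma)^{-1}\big(\langle R_{\gamma f}(z),z\rangle-p_{\gamma f}^2(z)-p_{\gamma g}^2(R_{\gamma f}(z))\big),$$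 $$F_\rho^{\mathrm{ADMM}}(v)=(2\rho)^{-1}\big(\langle R_{\rho f^*}(v),v\rangle-p_{\rho f^*}^2(v)-p_{\rho(g^*\circ-\mathrm{Id})}^2(R_{\rho f^*}(v))\big).$$ *)

theory Defs
  imports "HOL-Analysis.Analysis"
begin

text \<open>
  \<open>'a::euclidean_space\<close> plays the role of \<open>\<real>\<^sup>n\<close> with an arbitrary inner product \<open>\<bullet>\<close>; functions into
  \<open>\<real> \<union> {\<infinity>}\<close> are \<open>ereal\<close>-valued functions that never take the value \<open>-\<infinity>\<close>.
\<close>

definition ext_epigraph :: "('a \<Rightarrow> ereal) \<Rightarrow> ('a \<times> real) set" where
  "ext_epigraph \<phi> = {(x, t). \<phi> x \<le> ereal t}"

definition proper_fun :: "('a \<Rightarrow> ereal) \<Rightarrow> bool" where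
  "proper_fun \<phi> \<longleftrightarrow> (\<forall>x. \<phi> x \<noteq> -\<infinity>) \<and> (\<exists>x. \<phi> x \<noteq> \<infinity>)"

definition closed_fun :: "('a::topological_space \<Rightarrow> ereal) \<Rightarrow> bool" where
  "closed_fun \<phi> \<longleftrightarrow> closed (ext_epigraph \<phi>)"

definition convex_fun :: "('a::real_vector \<Rightarrow> ereal) \<Rightarrow> bool" where
  "convex_fun \<phi> \<longleftrightarrow> convex (ext_epigraph \<phi>)"

definition conjugate :: "('a::real_inner \<Rightarrow> ereal) \<Rightarrow> 'a \<Rightarrow> ereal" where
  "conjugate \<phi> y = (SUP x. ereal (y \<bullet> x) - \<phi> x)"

text \<open>
  In the operators below the subscript \<open>\<gamma>\<phi>\<close> is rendered as two arguments \<open>\<gamma>\<close> and \<open>\<phi>\<close>. The minimizer in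
  \<open>prox\<close> is unique for proper closed convex \<open>\<phi>\<close> and \<open>\<gamma> > 0\<close>; otherwise \<open>arg_min\<close> is an arbitrary choice.
\<close>

definition prox :: "real \<Rightarrow> ('a::real_inner \<Rightarrow> ereal) \<Rightarrow> 'a \<Rightarrow> 'a" where
  "prox \<gamma> \<phi> z = (ARG_MIN (\<lambda>x. \<phi> x + ereal (1 / (2 * \<gamma>) * (norm (x - z))\<^sup>2)) x. True)"

definition refl_prox :: "real \<Rightarrow> ('a::real_inner \<Rightarrow> ereal) \<Rightarrow> 'a \<Rightarrow> 'a" where
  "refl_prox \<gamma> \<phi> x = 2 *\<^sub>R prox \<gamma> \<phi> x - x"

definition r_fun :: "real \<Rightarrow> ('a::real_inner \<Rightarrow> ereal) \<Rightarrow> 'a \<Rightarrow> ereal" where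
  "r_fun \<gamma> \<phi> x = ereal \<gamma> * \<phi> x + ereal (1 / 2 * (norm x)\<^sup>2)"

text \<open>\<open>p2_fun\<close> is \<open>p\<^sup>2\<close>, where the superscript is a parameter and not a square.\<close>

definition p2_fun :: "real \<Rightarrow> ('a::real_inner \<Rightarrow> ereal) \<Rightarrow> 'a \<Rightarrow> ereal" where
  "p2_fun \<gamma> \<phi> x = 2 * conjugate (r_fun \<gamma> \<phi>) x - ereal (1 / 2 * (norm x)\<^sup>2)"

text \<open>
  For proper closed convex \<open>f\<close>, \<open>g\<close> and positive parameters every term in the two envelopes is finite,
  so the \<open>ereal\<close> conventions for \<open>\<infinity> - \<infinity>\<close> play no role.
\<close>

definition DR_envelope :: "('a::real_inner \<Rightarrow> ereal) \<Rightarrow> ('a \<Rightarrow> ereal) \<Rightarrow> real \<Rightarrow> 'a \<Rightarrow> ereal" where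
  "DR_envelope f g \<gamma> z =
     ereal (inverse (2 * \<gamma>)) *
       (ereal (refl_prox \<gamma> f z \<bullet> z) - p2_fun \<gamma> f z - p2_fun \<gamma> g (refl_prox \<gamma> f z))"

definition ADMM_envelope :: "('a::real_inner \<Rightarrow> ereal) \<Rightarrow> ('a \<Rightarrow> ereal) \<Rightarrow> real \<Rightarrow> 'a \<Rightarrow> ereal" where
  "ADMM_envelope f g \<rho> v =
     ereal (inverse (2 * \<rho>)) *
       (ereal (refl_prox \<rho> (conjugate f) v \<bullet> v) - p2_fun \<rho> (conjugate f) v
         - p2_fun \<rho> (conjugate g \<circ> uminus) (refl_prox \<rho> (conjugate f) v))"

end

theory Submission
  imports Defs
begin

text \<open>
  If \<open>u\<close> is a subgradient of \<open>\<phi>\<close> at \<open>p\<close> and \<open>z = p + \<gamma>u\<close>, then \<open>prox\<^bsub>\<gamma>\<phi>\<^esub>(z) = p\<close> and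
  \<open>p\<^sup>2\<^bsub>\<gamma>\<phi>\<^esub>(z)\<close> is an explicit expression in \<open>p\<close>, \<open>u\<close> and \<open>\<phi>(p)\<close>. Conjugation exchanges \<open>p\<close> and \<open>u\<close>, so
  the same holds for \<open>\<phi>\<^sup>*\<close> at \<open>z/\<gamma> = u + p/\<gamma>\<close>; comparing the two gives
  \<open>p\<^sup>2\<^bsub>\<phi>*/\<gamma>\<^esub>(z/\<gamma>) = -p\<^sup>2\<^bsub>\<gamma>\<phi>\<^esub>(z)/\<gamma>\<^sup>2\<close> and
  \<open>R\<^bsub>\<phi>*/\<gamma>\<^esub>(z/\<gamma>) = -R\<^bsub>\<gamma>\<phi>\<^esub>(z)/\<gamma>\<close>. The only analytic ingredient is that every \<open>z\<close> admits such
  a decomposition, which is the optimality condition of the proximal minimization problem.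
\<close>

text \<open>The real \<open>a\<close> names the value of \<open>\<phi>\<close> at \<open>p\<close>,
  so finiteness there is built in and later identities can be computed in the reals.\<close>

definition subgrad :: "('a::real_inner \<Rightarrow> ereal) \<Rightarrow> 'a \<Rightarrow> real \<Rightarrow> 'a \<Rightarrow> bool" where
  "subgrad \<phi> p a u \<longleftrightarrow> \<phi> p = ereal a \<and> (\<forall>x. ereal (a + u \<bullet> (x - p)) \<le> \<phi> x)"

text \<open>A point one unit below the graph is strictly separated from the closed convex epigraph.
  Comparison with the graph point above it shows that the hyperplane is not vertical
  (\<open>b > 0\<close>), so it can be solved for \<open>t\<close>.\<close>

lemma affine_minorant:
  fixes \<phi> :: "'a::euclidean_space \<Rightarrow> ereal"
  assumes "proper_fun \<phi>" "closed_fun \<phi>" "convex_fun \<phi>"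
  shows "\<exists>\<alpha> q. \<forall>x t. (x, t) \<in> ext_epigraph \<phi> \<longrightarrow> \<alpha> + q \<bullet> x \<le> t"
proof -
  obtain x0 where "\<phi> x0 \<noteq> \<infinity>" "\<phi> x0 \<noteq> -\<infinity>"
    using assms(1) by (auto simp: proper_fun_def)
  then obtain s where s: "\<phi> x0 = ereal s" by (cases "\<phi> x0") auto
  have "(x0, s - 1) \<notin> ext_epigraph \<phi>" using s by (simp add: ext_epigraph_def)
  then obtain ab c where sep: "ab \<bullet> (x0, s - 1) < c" "\<forall>y\<in>ext_epigraph \<phi>. c < ab \<bullet> y"
    using separating_hyperplane_closed_point[of "ext_epigraph \<phi>" "(x0, s - 1)"] assms(2,3)
    by (auto simp: closed_fun_def convex_fun_def)
  obtain a b where ab: "ab = (a, b)" by (cases ab)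
  have "(x0, s) \<in> ext_epigraph \<phi>" using s by (simp add: ext_epigraph_def)
  then have "c < a \<bullet> x0 + b * s" using sep(2) ab by auto
  moreover have "a \<bullet> x0 + b * (s - 1) < c" using sep(1) ab by auto
  ultimately have b: "b > 0" by (simp add: algebra_simps)
  have "c / b + (- (1 / b) *\<^sub>R a) \<bullet> x \<le> t" if "(x, t) \<in> ext_epigraph \<phi>" for x t
  proof -
    have "c < a \<bullet> x + b * t" using sep(2) ab that by auto
    with b show ?thesis by (simp add: field_simps)
  qed
  then show ?thesis by blast
qed

text \<open>The quadratic outgrows any affine minorant. Working with points of the epigraph makes
  the objective continuous, with closedness of \<open>E\<close> in the role of lower
  semicontinuity.\<close>

lemma compact_prox_sublevel:
  fixes E :: "('a::euclidean_space \<times> real) set"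
  assumes "closed E" and minor: "\<And>x t. (x, t) \<in> E \<Longrightarrow> \<alpha> + q \<bullet> x \<le> t" and "\<gamma> > 0"
  shows "compact {y \<in> E. snd y + 1 / (2 * \<gamma>) * (norm (fst y - z))\<^sup>2 \<le> c}" (is "compact ?S")
proof -
  have closed: "closed ?S"
  proof -
    have "closed {y::'a \<times> real. snd y + 1 / (2 * \<gamma>) * (norm (fst y - z))\<^sup>2 \<le> c}"
      by (intro closed_Collect_le continuous_intros)
    then have "closed (E \<inter> {y. snd y + 1 / (2 * \<gamma>) * (norm (fst y - z))\<^sup>2 \<le> c})"
      using assms(1) by (rule closed_Int[rotated])
    moreover have "?S = E \<inter> {y. snd y + 1 / (2 * \<gamma>) * (norm (fst y - z))\<^sup>2 \<le> c}" by blast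
    ultimately show ?thesis by simp
  qed
  \<comment> \<open>Completing the square: minorant plus quadratic is at most \<open>c\<close>
    exactly when \<open>x\<close> lies within squared distance \<open>K\<close> of
    \<open>w\<close>.\<close>
  define w where "w = z - \<gamma> *\<^sub>R q"
  define K where "K = 2 * \<gamma> * (c - \<alpha> - q \<bullet> z + \<gamma> / 2 * (q \<bullet> q))"
  define r where "r = sqrt K"
  have "?S \<subseteq> cball w r \<times> {\<alpha> + q \<bullet> w - norm q * r .. c}"
  proof (rule subrelI)
    fix x t assume "(x, t) \<in> ?S"
    then have "(x, t) \<in> E" and le: "t + (norm (x - z))\<^sup>2 / (2 * \<gamma>) \<le> c" by simp_all
    have t: "\<alpha> + q \<bullet> x \<le> t" using minor \<open>(x, t) \<in> E\<close> by blast
    have "\<alpha> + q \<bullet> x + (norm (x - z))\<^sup>2 / (2 * \<gamma>) \<le> c" using t le by linarith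
    then have "2 * \<gamma> * (\<alpha> + q \<bullet> x) + (norm (x - z))\<^sup>2 \<le> 2 * \<gamma> * c"
      using \<open>\<gamma> > 0\<close> by (simp add: field_simps)
    moreover have "(norm (x - w))\<^sup>2 - K = 2 * \<gamma> * (\<alpha> + q \<bullet> x) + (norm (x - z))\<^sup>2 - 2 * \<gamma> * c"
      unfolding w_def K_def power2_norm_eq_inner
      by (simp add: algebra_simps inner_commute)
    ultimately have "(norm (x - w))\<^sup>2 \<le> K" by linarith
    then have d: "norm (x - w) \<le> r" unfolding r_def by (rule real_le_rsqrt)
    have "- (q \<bullet> (x - w)) \<le> norm q * norm (x - w)"
      using Cauchy_Schwarz_ineq2[of q "x - w"] by linarith
    also have "\<dots> \<le> norm q * r" using d by (simp add: mult_left_mono)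
    finally have "q \<bullet> w - norm q * r \<le> q \<bullet> x" by (simp add: inner_diff_right)
    moreover have "0 \<le> (norm (x - z))\<^sup>2 / (2 * \<gamma>)" using \<open>\<gamma> > 0\<close> by simp
    ultimately show "(x, t) \<in> cball w r \<times> {\<alpha> + q \<bullet> w - norm q * r .. c}"
      using d t le by (auto simp: dist_norm norm_minus_commute)
  qed
  then have "bounded ?S" by (rule bounded_subset[rotated]) (intro bounded_Times bounded_cball bounded_closed_interval)
  with closed show ?thesis by (simp add: compact_eq_bounded_closed)
qed

text \<open>Here \<open>p\<close> is the proximal point of \<open>z\<close>, and
  \<open>u = (z - p) / \<gamma>\<close> is a subgradient by first-order optimality.\<close>

lemma subgrad_decomposition:
  fixes \<phi> :: "'a::euclidean_space \<Rightarrow> ereal"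
  assumes "proper_fun \<phi>" "closed_fun \<phi>" "convex_fun \<phi>" "\<gamma> > 0"
  obtains p a u where "z = p + \<gamma> *\<^sub>R u" "subgrad \<phi> p a u"
proof -
  let ?E = "ext_epigraph \<phi>"
  let ?h = "\<lambda>y::'a \<times> real. snd y + 1 / (2 * \<gamma>) * (norm (fst y - z))\<^sup>2"
  obtain x0 where "\<phi> x0 \<noteq> \<infinity>" "\<phi> x0 \<noteq> -\<infinity>"
    using assms(1) by (auto simp: proper_fun_def)
  then obtain s0 where s0: "(x0, s0) \<in> ?E" by (cases "\<phi> x0") (auto simp: ext_epigraph_def)
  obtain \<alpha> q where "\<And>x t. (x, t) \<in> ?E \<Longrightarrow> \<alpha> + q \<bullet> x \<le> t"
    using affine_minorant[OF assms(1-3)] by blast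
  then have "compact {y \<in> ?E. ?h y \<le> ?h (x0, s0)}"
    using assms(2,4) by (intro compact_prox_sublevel) (auto simp: closed_fun_def)
  moreover have "continuous_on {y \<in> ?E. ?h y \<le> ?h (x0, s0)} ?h" by (intro continuous_intros)
  ultimately obtain y where y: "y \<in> ?E" "?h y \<le> ?h (x0, s0)"
    and miny: "\<And>y'. y' \<in> ?E \<Longrightarrow> ?h y' \<le> ?h (x0, s0) \<Longrightarrow> ?h y \<le> ?h y'"
    using continuous_attains_inf[of "{y \<in> ?E. ?h y \<le> ?h (x0, s0)}" ?h] s0 by blast
  have min: "?h y \<le> ?h y'" if "y' \<in> ?E" for y'
    using y(2) miny[OF that] by linarith
  obtain p t where pt: "y = (p, t)" by (cases y)
  have "\<phi> p \<le> ereal t" "\<phi> p \<noteq> -\<infinity>"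
    using y(1) pt assms(1) by (auto simp: ext_epigraph_def proper_fun_def)
  then obtain a where a: "\<phi> p = ereal a" "a \<le> t" by (cases "\<phi> p") auto
  \<comment> \<open>A minimizing point of the epigraph lies on the graph, since lowering
    \<open>t\<close> would decrease the objective.\<close>
  have "t \<le> a" using min[of "(p, a)"] a pt by (simp add: ext_epigraph_def)
  with a have \<phi>p: "\<phi> p = ereal t" by simp
  define u where "u = (1 / \<gamma>) *\<^sub>R (z - p)"
  have sub: "t + u \<bullet> (x - p) \<le> s" if xs: "(x, s) \<in> ?E" for x s
  proof -
    \<comment> \<open>Move a fraction \<open>l\<close> from \<open>(p, t)\<close> towards
      \<open>(x, s)\<close> and divide the increase of the objective by \<open>l\<close>. The
      remaining quadratic term is of order \<open>l\<close> and vanishes in the limit.\<close>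
    have step: "0 \<le> s - t - u \<bullet> (x - p) + l / (2 * \<gamma>) * (norm (x - p))\<^sup>2" if l: "0 < l" "l < 1" for l
    proof -
      have "(1 - l) *\<^sub>R (p, t) + l *\<^sub>R (x, s) \<in> ?E"
        using assms(3) y(1) pt xs l by (intro convexD) (auto simp: convex_fun_def)
      then have "0 \<le> ?h ((1 - l) *\<^sub>R (p, t) + l *\<^sub>R (x, s)) - ?h y" using min by fastforce
      also have "?h ((1 - l) *\<^sub>R (p, t) + l *\<^sub>R (x, s)) - ?h y
          = l * (s - t - u \<bullet> (x - p) + l / (2 * \<gamma>) * (norm (x - p))\<^sup>2)"
        using \<open>\<gamma> > 0\<close> unfolding pt u_def power2_norm_eq_inner
        by (simp add: field_simps inner_add_left inner_add_right inner_diff_left inner_diff_right inner_commute)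
      finally show ?thesis using l by (simp add: zero_le_mult_iff)
    qed
    have "((\<lambda>l. s - t - u \<bullet> (x - p) + l / (2 * \<gamma>) * (norm (x - p))\<^sup>2) \<longlongrightarrow>
        s - t - u \<bullet> (x - p) + 0 / (2 * \<gamma>) * (norm (x - p))\<^sup>2) (at_right 0)"
      using \<open>\<gamma> > 0\<close> by (intro tendsto_intros) auto
    moreover have "\<forall>\<^sub>F l in at_right 0. 0 \<le> s - t - u \<bullet> (x - p) + l / (2 * \<gamma>) * (norm (x - p))\<^sup>2"
      by (rule eventually_mono[OF eventually_at_right_real[of 0 1]]) (use step in auto)
    ultimately have "0 \<le> s - t - u \<bullet> (x - p) + 0 / (2 * \<gamma>) * (norm (x - p))\<^sup>2"
      by (rule tendsto_lowerbound) simp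
    then show ?thesis by simp
  qed
  have "ereal (t + u \<bullet> (x - p)) \<le> \<phi> x" for x
    using assms(1) sub[of x] by (cases "\<phi> x") (auto simp: ext_epigraph_def proper_fun_def)
  then have "subgrad \<phi> p t u" using \<phi>p by (simp add: subgrad_def)
  moreover have "z = p + \<gamma> *\<^sub>R u" using \<open>\<gamma> > 0\<close> by (simp add: u_def)
  ultimately show ?thesis using that by blast
qed

text \<open>Adding the quadratic to the subgradient inequality makes the objective at
  \<open>x\<close> exceed its value at \<open>p\<close> by at least
  \<open>(norm (x - p))\<^sup>2 / (2 * \<gamma>)\<close>. The minimizer is thus unique, which
  determines the choice made by \<open>ARG_MIN\<close>.\<close>

lemma subgrad_prox:
  assumes "subgrad \<phi> p a u" "\<gamma> > 0"
  shows "prox \<gamma> \<phi> (p + \<gamma> *\<^sub>R u) = p"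
proof -
  let ?z = "p + \<gamma> *\<^sub>R u"
  let ?F = "\<lambda>x. \<phi> x + ereal (1 / (2 * \<gamma>) * (norm (x - ?z))\<^sup>2)"
  have Fp: "?F p = ereal (a + 1 / (2 * \<gamma>) * (norm (p - ?z))\<^sup>2)"
    using assms(1) by (simp add: subgrad_def)
  have lower: "ereal (a + 1 / (2 * \<gamma>) * (norm (p - ?z))\<^sup>2 + 1 / (2 * \<gamma>) * (norm (x - p))\<^sup>2) \<le> ?F x" for x
  proof -
    have "a + 1 / (2 * \<gamma>) * (norm (p - ?z))\<^sup>2 + 1 / (2 * \<gamma>) * (norm (x - p))\<^sup>2
        = a + u \<bullet> (x - p) + 1 / (2 * \<gamma>) * (norm (x - ?z))\<^sup>2"
      using \<open>\<gamma> > 0\<close> unfolding power2_norm_eq_inner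
      by (simp add: field_simps inner_add_left inner_add_right inner_diff_left inner_diff_right inner_commute)
    moreover have "ereal (a + u \<bullet> (x - p)) + ereal (1 / (2 * \<gamma>) * (norm (x - ?z))\<^sup>2) \<le> ?F x"
      using assms(1) by (intro add_right_mono) (simp add: subgrad_def)
    ultimately show ?thesis by (simp only: plus_ereal.simps)
  qed
  have less: "?F p < ?F x" if "x \<noteq> p" for x
  proof -
    have "0 < 1 / (2 * \<gamma>) * (norm (x - p))\<^sup>2" using that \<open>\<gamma> > 0\<close> by simp
    then have "?F p < ereal (a + 1 / (2 * \<gamma>) * (norm (p - ?z))\<^sup>2 + 1 / (2 * \<gamma>) * (norm (x - p))\<^sup>2)"
      unfolding Fp by simp
    then show ?thesis using lower[of x] by (rule less_le_trans)
  qed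
  show ?thesis
    unfolding prox_def arg_min_def is_arg_min_def
  proof (rule some_equality)
    show "True \<and> \<not> (\<exists>y. True \<and> ?F y < ?F p)"
      using less by (metis less_asym)
    show "x = p" if "True \<and> \<not> (\<exists>y. True \<and> ?F y < ?F x)" for x
      using that less by blast
  qed
qed

text \<open>The supremum in the conjugate of \<open>r_fun \<gamma> \<phi>\<close> is attained at
  \<open>p\<close>: elsewhere the subgradient inequality leaves a gap of at least
  \<open>(norm (x - p))\<^sup>2 / 2\<close>.\<close>

lemma subgrad_p2_fun:
  assumes "subgrad \<phi> p a u" "\<gamma> > 0"
  shows "p2_fun \<gamma> \<phi> (p + \<gamma> *\<^sub>R u)
    = ereal ((norm p)\<^sup>2 / 2 - (\<gamma> * norm u)\<^sup>2 / 2 + \<gamma> * (p \<bullet> u) - 2 * \<gamma> * a)"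
proof -
  let ?z = "p + \<gamma> *\<^sub>R u"
  let ?m = "?z \<bullet> p - \<gamma> * a - (norm p)\<^sup>2 / 2"
  have "conjugate (r_fun \<gamma> \<phi>) ?z = ereal ?m"
    unfolding conjugate_def
  proof (rule SUP_eqI)
    fix x
    have low: "ereal (a + u \<bullet> (x - p)) \<le> \<phi> x" using assms(1) by (simp add: subgrad_def)
    show "ereal (?z \<bullet> x) - r_fun \<gamma> \<phi> x \<le> ereal ?m"
    proof (cases "\<phi> x")
      case (real b)
      with low have "a + u \<bullet> (x - p) \<le> b" by simp
      then have "\<gamma> * (a + u \<bullet> (x - p)) \<le> \<gamma> * b" using \<open>\<gamma> > 0\<close> by simp
      moreover have "?z \<bullet> x - \<gamma> * (a + u \<bullet> (x - p)) - (norm x)\<^sup>2 / 2 = ?m - (norm (x - p))\<^sup>2 / 2"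
        unfolding power2_norm_eq_inner
        by (simp add: field_simps inner_add_left inner_add_right inner_diff_left inner_diff_right inner_commute)
      moreover have "0 \<le> (norm (x - p))\<^sup>2 / 2" by simp
      ultimately have "?z \<bullet> x - (\<gamma> * b + (norm x)\<^sup>2 / 2) \<le> ?m" by linarith
      then show ?thesis using real by (simp add: r_fun_def)
    qed (use low \<open>\<gamma> > 0\<close> in \<open>auto simp: r_fun_def\<close>)
  next
    fix y assume "\<And>x. x \<in> UNIV \<Longrightarrow> ereal (?z \<bullet> x) - r_fun \<gamma> \<phi> x \<le> y"
    then have "ereal (?z \<bullet> p) - r_fun \<gamma> \<phi> p \<le> y" by blast
    then show "ereal ?m \<le> y" using assms(1) by (simp add: r_fun_def subgrad_def algebra_simps)
  qed
  moreover have "2 * ?m - (norm ?z)\<^sup>2 / 2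
      = (norm p)\<^sup>2 / 2 - (\<gamma> * norm u)\<^sup>2 / 2 + \<gamma> * (p \<bullet> u) - 2 * \<gamma> * a"
    unfolding power_mult_distrib power2_norm_eq_inner
    by (simp add: field_simps power2_eq_square inner_add_left inner_add_right inner_commute)
  ultimately show ?thesis by (simp add: p2_fun_def)
qed

text \<open>Testing the supremum at \<open>p\<close> bounds \<open>conjugate \<phi>\<close> below by
  an affine function of slope \<open>p\<close>; equality at \<open>u\<close> is the Fenchel-Young
  equality.\<close>

lemma subgrad_conjugate:
  assumes "subgrad \<phi> p a u"
  shows "subgrad (conjugate \<phi>) u (p \<bullet> u - a) p"
proof -
  have \<phi>p: "\<phi> p = ereal a" and low: "\<And>x. ereal (a + u \<bullet> (x - p)) \<le> \<phi> x"
    using assms by (auto simp: subgrad_def)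
  have ge: "ereal (y \<bullet> p - a) \<le> conjugate \<phi> y" for y
    unfolding conjugate_def by (rule SUP_upper2[of p]) (simp_all add: \<phi>p)
  have "ereal (u \<bullet> x) - \<phi> x \<le> ereal (u \<bullet> p - a)" for x
    using low[of x] by (cases "\<phi> x") (auto simp: inner_diff_right)
  then have "conjugate \<phi> u \<le> ereal (u \<bullet> p - a)"
    unfolding conjugate_def by (rule SUP_least)
  with ge[of u] ge show ?thesis
    by (auto simp: subgrad_def inner_diff_right inner_commute intro!: antisym)
qed

lemma subgrad_comp_uminus:
  assumes "subgrad \<phi> p a u"
  shows "subgrad (\<phi> \<circ> uminus) (- p) a (- u)"
  unfolding subgrad_def
proof (intro conjI allI)
  show "(\<phi> \<circ> uminus) (- p) = ereal a" using assms by (simp add: subgrad_def)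
  fix x
  have "ereal (a + u \<bullet> (- x - p)) \<le> \<phi> (- x)" using assms unfolding subgrad_def by blast
  then show "ereal (a + - u \<bullet> (x - - p)) \<le> (\<phi> \<circ> uminus) x"
    by (simp add: inner_diff_right inner_add_right)
qed

theorem proposition4p8:
  fixes f g :: "'a::euclidean_space \<Rightarrow> ereal"
    and \<rho> \<gamma> :: real
    and z v :: 'a
  assumes "proper_fun f" "closed_fun f" "convex_fun f"
    and "proper_fun g" "closed_fun g" "convex_fun g"
    and "\<rho> > 0" "\<gamma> > 0" "\<rho> = inverse \<gamma>"
    and "z = inverse \<rho> *\<^sub>R v" "z = \<gamma> *\<^sub>R v"
  shows "ADMM_envelope f g \<rho> v = - DR_envelope f g \<gamma> z"
proof -
  obtain p a u where z: "z = p + \<gamma> *\<^sub>R u" and f: "subgrad f p a u"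
    using subgrad_decomposition[OF assms(1-3,8)] by blast
  let ?R = "refl_prox \<gamma> f z"
  \<comment> \<open>The envelope evaluates the term of \<open>g\<close> at the reflected point, so
    that is the point to decompose.\<close>
  obtain p' a' u' where R: "?R = p' + \<gamma> *\<^sub>R u'" and g: "subgrad g p' a' u'"
    using subgrad_decomposition[OF assms(4-6,8)] by blast
  have \<rho>\<gamma>: "\<rho> * \<gamma> = 1" using assms(8,9) by simp
  have vz: "v = \<rho> *\<^sub>R z" using assms(11) \<rho>\<gamma> by simp
  \<comment> \<open>This is the decomposition of \<open>v\<close> for \<open>conjugate f\<close>,
    with \<open>p\<close> and \<open>u\<close> exchanged.\<close>
  then have v: "v = u + \<rho> *\<^sub>R p" using z \<rho>\<gamma> by (simp add: scaleR_add_right)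
  have pf: "prox \<gamma> f z = p" using subgrad_prox[OF f assms(8)] z by simp
  have pc: "prox \<rho> (conjugate f) v = u"
    using subgrad_prox[OF subgrad_conjugate[OF f] assms(7)] v by simp
  have "refl_prox \<rho> (conjugate f) v = - (\<rho> *\<^sub>R ?R)"
    using \<rho>\<gamma> unfolding refl_prox_def pf pc unfolding z v
    by (simp add: algebra_simps scaleR_2)
  moreover have "- (\<rho> *\<^sub>R ?R) = - u' + \<rho> *\<^sub>R (- p')"
    unfolding R using \<rho>\<gamma> by (simp add: scaleR_add_right)
  \<comment> \<open>The first form serves the inner product; the second is the decomposition for
    \<open>conjugate g \<circ> uminus\<close>, whose subgradient at \<open>- u'\<close> is
    \<open>- p'\<close>.\<close>
  ultimately have Rc: "refl_prox \<rho> (conjugate f) v = - (\<rho> *\<^sub>R ?R)"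
    "refl_prox \<rho> (conjugate f) v = - u' + \<rho> *\<^sub>R (- p')" by simp_all
  \<comment> \<open>here \<open>b\<close> stands for \<open>\<phi>(q)\<close> and \<open>q \<bullet> w - b\<close> for \<open>\<phi>\<^sup>*(w)\<close>, so this is \<open>p\<^sup>2\<^bsub>\<rho>\<phi>*\<^esub> = -\<rho>\<^sup>2p\<^sup>2\<^bsub>\<gamma>\<phi>\<^esub>\<close>\<close>
  have scale: "(norm w)\<^sup>2 / 2 - (\<rho> * norm q)\<^sup>2 / 2 + \<rho> * (w \<bullet> q) - 2 * \<rho> * (q \<bullet> w - b)
      = - (\<rho>\<^sup>2 * ((norm q)\<^sup>2 / 2 - (\<gamma> * norm w)\<^sup>2 / 2 + \<gamma> * (q \<bullet> w) - 2 * \<gamma> * b))" for q w :: 'a and b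
    using assms(8) unfolding assms(9)
    by (simp add: field_simps power2_eq_square inner_commute)
  define A where "A = (norm p)\<^sup>2 / 2 - (\<gamma> * norm u)\<^sup>2 / 2 + \<gamma> * (p \<bullet> u) - 2 * \<gamma> * a"
  define B where "B = (norm p')\<^sup>2 / 2 - (\<gamma> * norm u')\<^sup>2 / 2 + \<gamma> * (p' \<bullet> u') - 2 * \<gamma> * a'"
  have 1: "p2_fun \<gamma> f z = ereal A"
    using subgrad_p2_fun[OF f assms(8)] z by (simp add: A_def)
  have 2: "p2_fun \<gamma> g ?R = ereal B"
    using subgrad_p2_fun[OF g assms(8)] R by (simp add: B_def)
  have 3: "p2_fun \<rho> (conjugate f) v = ereal (- (\<rho>\<^sup>2 * A))"
    using subgrad_p2_fun[OF subgrad_conjugate[OF f] assms(7)] v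
    unfolding scale A_def by simp
  have 4: "p2_fun \<rho> (conjugate g \<circ> uminus) (refl_prox \<rho> (conjugate f) v) = ereal (- (\<rho>\<^sup>2 * B))"
    using subgrad_p2_fun[OF subgrad_comp_uminus[OF subgrad_conjugate[OF g]] assms(7)]
    unfolding Rc(2) norm_minus_cancel inner_minus_left inner_minus_right minus_minus scale B_def
    by simp
  have "refl_prox \<rho> (conjugate f) v \<bullet> v = - (\<rho>\<^sup>2 * (?R \<bullet> z))"
    unfolding Rc(1) by (simp add: vz power2_eq_square)
  then have "ADMM_envelope f g \<rho> v = ereal (inverse (2 * \<rho>) * (- (\<rho>\<^sup>2 * (?R \<bullet> z - A - B))))"
    unfolding ADMM_envelope_def 3 4 by (simp add: algebra_simps)
  \<comment> \<open>The prefactors match because \<open>\<rho>\<^sup>2 / (2 * \<rho>) = \<rho> / 2 =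
    1 / (2 * \<gamma>)\<close>.\<close>
  also have "inverse (2 * \<rho>) * (- (\<rho>\<^sup>2 * (?R \<bullet> z - A - B))) = - (inverse (2 * \<gamma>) * (?R \<bullet> z - A - B))"
    using assms(8) unfolding assms(9) by (simp add: field_simps power2_eq_square)
  also have "ereal \<dots> = - DR_envelope f g \<gamma> z"
    unfolding DR_envelope_def 1 2 by simp
  finally show ?thesis .
qed

end
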